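(* Let $(\mathfrak g,\pi_1,\pi_2)$ be a compatible pre-Lie algebra over a field $\mathbb K$. If $\mathcal H^2(\mathfrak g;\mathfrak g)=0$, then $(\mathfrak g,\pi_1,\pi_2)$ is rigid.
   Context: Pre-Lie algebra: a vector space with a bilinear product $\cdot$ satisfying $(x\cdot y)\cdot z-x\cdot(y\cdot z)=(y\cdot x)\cdot z-y\cdot(x\cdot z)$ (similarly over the ring $\mathbb K[[t]]$). Compatible pre-Lie algebra: a triple $(\mathfrak g,\cdot,\ast)$ where $\cdot$ and $\ast$ are pre-Lie products on $\mathfrak g$ such that for all $x,y,z$: $(x\ast y)\cdot z+(x\cdot y)\ast z-x\cdot(y\ast z)-x\ast(y\cdot z)-(y\ast x)\cdot z-(y\cdot x)\ast z+y\cdot(x\ast z)+y\ast(x\cdot z)=0$. Here $(\mathfrak g,\pi_1,\pi_2)$ means $x\cdot y=\pi_1(x,y)$, $x\ast y=\pi_2(x,y)$. Second cohomology: for a pre-Lie product $\pi$ on $\mathfrak g$, $f\in\mathrm{Hom}(\mathfrak g,\mathfrak g)$ and $\omega\in\mathrm{Hom}(\otimes^2\mathfrak g,\mathfrak g)$, put $(\delta_\pi f)(x,y)=\pi(x,f(y))+\pi(f(x),y)-f(\pi(x,y))$ and $(\delta_\pi\omega)(x,y,z)=\pi(x,\omega(y,z))-\pi(y,\omega(x,z))+\pi(\omega(y,x),z)-\pi(\omega(x,y),z)-\omega(y,\pi(x,z))+\omega(x,\pi(y,z))-\omega(\pi(x,y)-\pi(y,x),z)$. A $2$-cocycle is a pair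 $(\omega_1,\omega_2)$ with $(\delta_{\pi_1}\omega_1,\ \delta_{\pi_2}\omega_1+\delta_{\pi_1}\omega_2,\ \delta_{\pi_2}\omega_2)=0$; a $2$-coboundary is a pair of the form $(\delta_{\pi_1}f,\delta_{\pi_2}f)$ with $f\in\mathrm{Hom}(\mathfrak g,\mathfrak g)$; $\mathcal H^2(\mathfrak g;\mathfrak g)$ is the quotient of $2$-cocycles by $2$-coboundaries. Formal deformations: a $1$-parameter formal deformation of $(\mathfrak g,\pi_1,\pi_2)$ is a pair of $\mathbb K[[t]]$-bilinear maps $\pi_1^t=\pi_1+\sum_{i\ge1}\pi_1^it^i$, $\pi_2^t=\pi_2+\sum_{i\ge1}\pi_2^it^i$ on $\mathfrak g[[t]]$, with $\pi_1^i,\pi_2^i:\mathfrak g\otimes\mathfrak g\to\mathfrak g$ linear, such that $(\mathfrak g[[t]],\pi_1^t,\pi_2^t)$ is a compatible pre-Lie algebra. It is trivial if there is a power series $\Phi_t=\sum_{i\ge0}\varphi_it^i$ with $\varphi_i:\mathfrak g\to\mathfrak g$ linear and $\varphi_0=\mathrm{Id}$ such that $\Phi_t\circ\pi_1^t=\pi_1\circ(\Phi_t\times\Phi_t)$ and $\Phi_t\circ\pi_2^t=\pi_2\circ(\Phi_t\times\Phi_t)$ (with $\pi_1,\pi_2$ extended $\mathbb K[[t]]$-bilinearly, i.e. coefficientwise in powers of $t$). $(\mathfrak g,\pi_1,\pi_2)$ is rigid if all its $1$-parameter formal deformations are trivial. *)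

theory Defs
  imports
    "HOL-Computational_Algebra.Formal_Power_Series"
    "HOL-Library.Function_Algebras"
    "HOL-Library.Product_Plus"
begin

definition bilinear_map ::
  "('r::comm_ring_1 \<Rightarrow> 'a::ab_group_add \<Rightarrow> 'a) \<Rightarrow> ('a \<Rightarrow> 'a \<Rightarrow> 'a) \<Rightarrow> bool" where
  "bilinear_map scale B \<longleftrightarrow>
     (\<forall>x. module_hom scale scale (B x)) \<and> (\<forall>y. module_hom scale scale (\<lambda>x. B x y))"

text \<open>Scalars form a commutative ring, so that the same notion serves both for algebras over a
  field \<open>K\<close> and for algebras over \<open>K[[t]]\<close>.\<close>

locale pre_lie_algebra = module scale
  for scale :: "'r::comm_ring_1 \<Rightarrow> 'a::ab_group_add \<Rightarrow> 'a" +
  fixes p :: "'a \<Rightarrow> 'a \<Rightarrow> 'a"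
  assumes bilinear: "bilinear_map scale p"
    and left_symmetric: "p (p x y) z - p x (p y z) = p (p y x) z - p y (p x z)"

locale compatible_pre_lie_algebra =
  P1: pre_lie_algebra scale p1 + P2: pre_lie_algebra scale p2
  for scale :: "'r::comm_ring_1 \<Rightarrow> 'a::ab_group_add \<Rightarrow> 'a"
    and p1 p2 :: "'a \<Rightarrow> 'a \<Rightarrow> 'a" +
  assumes compatible:
    "p1 (p2 x y) z + p2 (p1 x y) z - p1 x (p2 y z) - p2 x (p1 y z)
     - p1 (p2 y x) z - p2 (p1 y x) z + p1 y (p2 x z) + p2 y (p1 x z) = 0"

definition delta1 :: "('a::ab_group_add \<Rightarrow> 'a \<Rightarrow> 'a) \<Rightarrow> ('a \<Rightarrow> 'a) \<Rightarrow> 'a \<Rightarrow> 'a \<Rightarrow> 'a" where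
  "delta1 p f = (\<lambda>x y. p x (f y) + p (f x) y - f (p x y))"

definition delta2 ::
  "('a::ab_group_add \<Rightarrow> 'a \<Rightarrow> 'a) \<Rightarrow> ('a \<Rightarrow> 'a \<Rightarrow> 'a) \<Rightarrow> 'a \<Rightarrow> 'a \<Rightarrow> 'a \<Rightarrow> 'a" where
  "delta2 p w = (\<lambda>x y z.
     p x (w y z) - p y (w x z) + p (w y x) z - p (w x y) z
     - w y (p x z) + w x (p y z) - w (p x y - p y x) z)"

definition cocycles2 ::
  "('k::comm_ring_1 \<Rightarrow> 'a::ab_group_add \<Rightarrow> 'a) \<Rightarrow> ('a \<Rightarrow> 'a \<Rightarrow> 'a) \<Rightarrow> ('a \<Rightarrow> 'a \<Rightarrow> 'a)
    \<Rightarrow> (('a \<Rightarrow> 'a \<Rightarrow> 'a) \<times> ('a \<Rightarrow> 'a \<Rightarrow> 'a)) set" where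
  "cocycles2 scale p1 p2 = {(w1, w2).
     bilinear_map scale w1 \<and> bilinear_map scale w2 \<and>
     delta2 p1 w1 = 0 \<and> delta2 p2 w1 + delta2 p1 w2 = 0 \<and> delta2 p2 w2 = 0}"

definition coboundaries2 ::
  "('k::comm_ring_1 \<Rightarrow> 'a::ab_group_add \<Rightarrow> 'a) \<Rightarrow> ('a \<Rightarrow> 'a \<Rightarrow> 'a) \<Rightarrow> ('a \<Rightarrow> 'a \<Rightarrow> 'a)
    \<Rightarrow> (('a \<Rightarrow> 'a \<Rightarrow> 'a) \<times> ('a \<Rightarrow> 'a \<Rightarrow> 'a)) set" where
  "coboundaries2 scale p1 p2 = {(delta1 p1 f, delta1 p2 f) | f. module_hom scale scale f}"

definition cohomologous2 ::
  "('k::comm_ring_1 \<Rightarrow> 'a::ab_group_add \<Rightarrow> 'a) \<Rightarrow> ('a \<Rightarrow> 'a \<Rightarrow> 'a) \<Rightarrow> ('a \<Rightarrow> 'a \<Rightarrow> 'a)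
    \<Rightarrow> (('a \<Rightarrow> 'a \<Rightarrow> 'a) \<times> ('a \<Rightarrow> 'a \<Rightarrow> 'a)) rel" where
  "cohomologous2 scale p1 p2 =
     {(c, d) \<in> cocycles2 scale p1 p2 \<times> cocycles2 scale p1 p2. c - d \<in> coboundaries2 scale p1 p2}"

definition cohomology2 ::
  "('k::comm_ring_1 \<Rightarrow> 'a::ab_group_add \<Rightarrow> 'a) \<Rightarrow> ('a \<Rightarrow> 'a \<Rightarrow> 'a) \<Rightarrow> ('a \<Rightarrow> 'a \<Rightarrow> 'a)
    \<Rightarrow> (('a \<Rightarrow> 'a \<Rightarrow> 'a) \<times> ('a \<Rightarrow> 'a \<Rightarrow> 'a)) set set" where
  "cohomology2 scale p1 p2 = cocycles2 scale p1 p2 // cohomologous2 scale p1 p2"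

definition cohomology2_zero ::
  "('k::comm_ring_1 \<Rightarrow> 'a::ab_group_add \<Rightarrow> 'a) \<Rightarrow> ('a \<Rightarrow> 'a \<Rightarrow> 'a) \<Rightarrow> ('a \<Rightarrow> 'a \<Rightarrow> 'a)
    \<Rightarrow> (('a \<Rightarrow> 'a \<Rightarrow> 'a) \<times> ('a \<Rightarrow> 'a \<Rightarrow> 'a)) set" where
  "cohomology2_zero scale p1 p2 = cohomologous2 scale p1 p2 `` {0}"

text \<open>The module \<open>g[[t]]\<close> over \<open>K[[t]]\<close> is the type \<open>'a fps\<close> with the following scalar action.\<close>

definition fps_scale ::
  "('k::comm_ring_1 \<Rightarrow> 'a::ab_group_add \<Rightarrow> 'a) \<Rightarrow> 'k fps \<Rightarrow> 'a fps \<Rightarrow> 'a fps" where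
  "fps_scale scale c v = Abs_fps (\<lambda>n. \<Sum>i\<le>n. scale (fps_nth c i) (fps_nth v (n - i)))"

text \<open>The operators on \<open>g[[t]]\<close> given by \<open>\<Sum>i. \<phi>\<^sub>i t\<^sup>i\<close> and by \<open>\<Sum>i. \<pi>\<^sub>i t\<^sup>i\<close>; in the second one, the
  coefficient of \<open>t\<^sup>n\<close> is the sum of \<open>\<pi>\<^sub>i(x\<^sub>j, y\<^sub>k)\<close> over all \<open>i + j + k = n\<close>.\<close>

definition series_map :: "(nat \<Rightarrow> 'a::ab_group_add \<Rightarrow> 'a) \<Rightarrow> 'a fps \<Rightarrow> 'a fps" where
  "series_map \<phi> x = Abs_fps (\<lambda>n. \<Sum>i\<le>n. \<phi> i (fps_nth x (n - i)))"

definition series_product ::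
  "(nat \<Rightarrow> 'a::ab_group_add \<Rightarrow> 'a \<Rightarrow> 'a) \<Rightarrow> 'a fps \<Rightarrow> 'a fps \<Rightarrow> 'a fps" where
  "series_product P x y =
     Abs_fps (\<lambda>n. \<Sum>i\<le>n. \<Sum>j\<le>n - i. P i (fps_nth x j) (fps_nth y (n - i - j)))"

definition extend_product :: "('a::ab_group_add \<Rightarrow> 'a \<Rightarrow> 'a) \<Rightarrow> 'a fps \<Rightarrow> 'a fps \<Rightarrow> 'a fps" where
  "extend_product p x y = Abs_fps (\<lambda>n. \<Sum>j\<le>n. p (fps_nth x j) (fps_nth y (n - j)))"

text \<open>A deformation is given by its sequences of coefficients \<open>P1 i\<close> and \<open>P2 i\<close>, including the
  coefficients at \<open>i = 0\<close>, which are the original products.\<close>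

definition formal_deformation ::
  "('k::comm_ring_1 \<Rightarrow> 'a::ab_group_add \<Rightarrow> 'a) \<Rightarrow> ('a \<Rightarrow> 'a \<Rightarrow> 'a) \<Rightarrow> ('a \<Rightarrow> 'a \<Rightarrow> 'a)
    \<Rightarrow> (nat \<Rightarrow> 'a \<Rightarrow> 'a \<Rightarrow> 'a) \<Rightarrow> (nat \<Rightarrow> 'a \<Rightarrow> 'a \<Rightarrow> 'a) \<Rightarrow> bool" where
  "formal_deformation scale p1 p2 P1 P2 \<longleftrightarrow>
     P1 0 = p1 \<and> P2 0 = p2 \<and>
     (\<forall>i. bilinear_map scale (P1 i)) \<and> (\<forall>i. bilinear_map scale (P2 i)) \<and>
     compatible_pre_lie_algebra (fps_scale scale) (series_product P1) (series_product P2)"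

definition trivial_deformation ::
  "('k::comm_ring_1 \<Rightarrow> 'a::ab_group_add \<Rightarrow> 'a) \<Rightarrow> ('a \<Rightarrow> 'a \<Rightarrow> 'a) \<Rightarrow> ('a \<Rightarrow> 'a \<Rightarrow> 'a)
    \<Rightarrow> (nat \<Rightarrow> 'a \<Rightarrow> 'a \<Rightarrow> 'a) \<Rightarrow> (nat \<Rightarrow> 'a \<Rightarrow> 'a \<Rightarrow> 'a) \<Rightarrow> bool" where
  "trivial_deformation scale p1 p2 P1 P2 \<longleftrightarrow>
     (\<exists>\<phi>. (\<forall>i. module_hom scale scale (\<phi> i)) \<and> \<phi> 0 = id \<and>
        (\<forall>x y. series_map \<phi> (series_product P1 x y)
               = extend_product p1 (series_map \<phi> x) (series_map \<phi> y)) \<and>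
        (\<forall>x y. series_map \<phi> (series_product P2 x y)
               = extend_product p2 (series_map \<phi> x) (series_map \<phi> y)))"

definition rigid ::
  "('k::comm_ring_1 \<Rightarrow> 'a::ab_group_add \<Rightarrow> 'a) \<Rightarrow> ('a \<Rightarrow> 'a \<Rightarrow> 'a) \<Rightarrow> ('a \<Rightarrow> 'a \<Rightarrow> 'a) \<Rightarrow> bool" where
  "rigid scale p1 p2 \<longleftrightarrow>
     (\<forall>P1 P2. formal_deformation scale p1 p2 P1 P2 \<longrightarrow> trivial_deformation scale p1 p2 P1 P2)"

end

theory Submission
  imports Defs
begin

text \<open>The trivialising series \<open>\<phi>\<close> is built coefficient by coefficient. If \<open>\<phi>\<close> intertwines the
  products modulo \<open>t\<^sup>n\<close>, the \<open>t\<^sup>n\<close>-coefficients of \<open>\<phi> \<circ> \<pi>\<^sub>k\<^sup>t - \<pi>\<^sub>k \<circ> (\<phi> \<times> \<phi>)\<close>, \<open>k = 1, 2\<close>, form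
  a \<open>2\<close>-cocycle. Indeed, applying \<open>\<phi>\<close> to the pre-Lie and compatibility identities of the
  deformation and comparing with those of the original products at \<open>\<phi> x\<close>, \<open>\<phi> y\<close>, \<open>\<phi> z\<close>
  leaves exactly the cocycle condition in degree \<open>n\<close>. Adding \<open>f t\<^sup>n\<close> to \<open>\<phi>\<close> changes this cocycle
  by the coboundary of \<open>-f\<close>, so it can be killed. Inverses of power series are never needed.\<close>

section \<open>Reindexing sums over tuples of fixed total degree\<close>

lemma sum_triangle_assoc:
  fixes f :: "nat \<Rightarrow> nat \<Rightarrow> nat \<Rightarrow> 'a::comm_monoid_add"
  shows "(\<Sum>m\<le>n. \<Sum>i\<le>m. f i (m - i) (n - m)) = (\<Sum>i\<le>n. \<Sum>j\<le>n - i. f i j (n - i - j))"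
  by (simp add: sum.Sigma, rule sum.reindex_bij_witness[where i = "\<lambda>(i, j). (i + j, i)" and j = "\<lambda>(m, i). (i, m - i)"],
      auto simp: split_beta)

lemma sum_triangle_swap:
  fixes f :: "nat \<Rightarrow> nat \<Rightarrow> nat \<Rightarrow> 'a::comm_monoid_add"
  shows "(\<Sum>i\<le>n. \<Sum>j\<le>n - i. f i j (n - i - j)) = (\<Sum>i\<le>n. \<Sum>j\<le>n - i. f j i (n - i - j))"
  by (simp add: sum.Sigma, rule sum.reindex_bij_witness[where i = "\<lambda>(i, j). (j, i)" and j = "\<lambda>(i, j). (j, i)"],
      auto simp: split_beta add.commute)

text \<open>Both sides run over quadruples (a, b, c, d) with total n; the left groups them by a + b,
  the right by a + c.\<close>

lemma sum_quadruple_swap: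
  fixes f :: "nat \<Rightarrow> nat \<Rightarrow> nat \<Rightarrow> nat \<Rightarrow> 'a::comm_monoid_add"
  shows "(\<Sum>j\<le>n. \<Sum>i\<le>j. \<Sum>k\<le>n - j. f i (j - i) k (n - j - k))
    = (\<Sum>m\<le>n. \<Sum>j\<le>n - m. \<Sum>i\<le>m. f i j (m - i) (n - m - j))"
  by (simp add: sum.Sigma, rule sum.reindex_bij_witness[where i = "\<lambda>(m, j, i). (i + j, i, m - i)"
        and j = "\<lambda>(j, i, k). (i + k, j - i, i)"],
      auto simp: split_beta algebra_simps)

section \<open>Biadditive products and polarised left-symmetry\<close>

text \<open>A scalar-free form of bilinearity, so that the same rules apply to products on g and to
  their extensions to g[[t]].\<close>

definition biadditive :: "('a::ab_group_add \<Rightarrow> 'a \<Rightarrow> 'a) \<Rightarrow> bool" where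
  "biadditive B \<longleftrightarrow> (\<forall>x. additive (B x)) \<and> (\<forall>y. additive (\<lambda>x. B x y))"

lemma biadditive_simps:
  assumes "biadditive B"
  shows "B (x + y) z = B x z + B y z" "B z (x + y) = B z x + B z y"
    "B (x - y) z = B x z - B y z" "B z (x - y) = B z x - B z y"
    "B 0 z = 0" "B z 0 = 0" "B (- x) z = - B x z" "B z (- x) = - B z x"
    "B (sum g S) z = (\<Sum>i\<in>S. B (g i) z)" "B z (sum g S) = (\<Sum>i\<in>S. B z (g i))"
  using assms additive.add[of "B z"] additive.add[of "\<lambda>x. B x z"]
    additive.diff[of "B z"] additive.diff[of "\<lambda>x. B x z"]
    additive.zero[of "B z"] additive.zero[of "\<lambda>x. B x z"]
    additive.minus[of "B z"] additive.minus[of "\<lambda>x. B x z"]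
    additive.sum[of "B z" g S] additive.sum[of "\<lambda>x. B x z" g S]
  unfolding biadditive_def by auto

lemma module_hom_imp_additive: "module_hom s1 s2 f \<Longrightarrow> additive f"
  by (simp add: module_hom_iff additive_def)

lemma bilinear_map_imp_biadditive: "bilinear_map scale B \<Longrightarrow> biadditive B"
  by (auto simp: bilinear_map_def biadditive_def intro: module_hom_imp_additive)

lemma additive_series_map:
  assumes "\<And>i. additive (\<phi> i)"
  shows "additive (series_map \<phi>)"
  by (simp add: additive_def series_map_def fps_eq_iff additive.add[OF assms] sum.distrib)

lemma biadditive_extend_product:
  assumes "biadditive p"
  shows "biadditive (extend_product p)"
  by (simp add: biadditive_def additive_def extend_product_def fps_eq_iff
      biadditive_simps[OF assms] sum.distrib)

text \<open>The polarisation of the left-symmetry identity: \<open>p\<close> is pre-Lie iff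
  \<open>left_sym p p\<close> vanishes, and compatibility is the vanishing of
  \<open>left_sym p q + left_sym q p\<close>.\<close>

definition left_sym ::
  "('a::ab_group_add \<Rightarrow> 'a \<Rightarrow> 'a) \<Rightarrow> ('a \<Rightarrow> 'a \<Rightarrow> 'a) \<Rightarrow> 'a \<Rightarrow> 'a \<Rightarrow> 'a \<Rightarrow> 'a" where
  "left_sym p q x y z = p (q x y) z - p x (q y z) - p (q y x) z + p y (q x z)"

text \<open>For biadditive \<open>p\<close>, the differential is, up to sign, the part linear in
  \<open>w\<close> of the left-symmetry expression of \<open>p + w\<close>.\<close>

lemma delta2_eq_left_sym:
  assumes "biadditive w"
  shows "delta2 p w x y z = - (left_sym p w x y z + left_sym w p x y z)"
  by (simp add: delta2_def left_sym_def biadditive_simps[OF assms])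

lemma pre_lie_algebra_left_sym: "pre_lie_algebra scale p \<Longrightarrow> left_sym p p x y z = 0"
  using pre_lie_algebra.left_symmetric[of scale p x y z] by (simp add: left_sym_def algebra_simps)

lemma compatible_pre_lie_algebra_left_sym:
  assumes "compatible_pre_lie_algebra scale p q"
  shows "left_sym p p x y z = 0" "left_sym q q x y z = 0"
    "left_sym p q x y z + left_sym q p x y z = 0"
proof -
  interpret compatible_pre_lie_algebra scale p q by fact
  show "left_sym p p x y z = 0" "left_sym q q x y z = 0"
    by (rule pre_lie_algebra_left_sym, unfold_locales)+
  show "left_sym p q x y z + left_sym q p x y z = 0"
    using compatible[of x y z] by (simp add: left_sym_def algebra_simps)
qed

text \<open>Through this formula the identities of the original products pass to arbitrary power
  series.\<close>

lemma left_sym_extend_product: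
  assumes p: "biadditive p"
  shows "fps_nth (left_sym (extend_product p) (extend_product q) X Y Z) n
    = (\<Sum>i\<le>n. \<Sum>j\<le>n - i. left_sym p q (fps_nth X i) (fps_nth Y j) (fps_nth Z (n - i - j)))"
proof -
  have L: "fps_nth (extend_product p (extend_product q X Y) Z) n
      = (\<Sum>i\<le>n. \<Sum>j\<le>n - i. p (q (fps_nth X i) (fps_nth Y j)) (fps_nth Z (n - i - j)))" for X Y Z
    using sum_triangle_assoc[of "\<lambda>i j k. p (q (fps_nth X i) (fps_nth Y j)) (fps_nth Z k)" n]
    by (simp add: extend_product_def biadditive_simps[OF p])
  have R: "fps_nth (extend_product p X (extend_product q Y Z)) n
      = (\<Sum>i\<le>n. \<Sum>j\<le>n - i. p (fps_nth X i) (q (fps_nth Y j) (fps_nth Z (n - i - j))))" for X Y Z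
    by (simp add: extend_product_def biadditive_simps[OF p])
  \<comment> \<open>In the two terms with \<open>X\<close> and \<open>Y\<close> exchanged, the first
    two indices are swapped so that all four sums align.\<close>
  show ?thesis
    unfolding left_sym_def fps_add_nth fps_sub_nth L R
      sum_triangle_swap[of "\<lambda>i j k. p (q (fps_nth Y i) (fps_nth X j)) (fps_nth Z k)" n]
      sum_triangle_swap[of "\<lambda>i j k. p (fps_nth Y i) (q (fps_nth X j) (fps_nth Z k))" n]
    by (simp add: sum.distrib sum_subtractf)
qed

section \<open>Defects of a power series of maps\<close>

text \<open>This is the t^n coefficient of \<phi> applied to the \<open>P\<close>-product minus the
  \<open>p\<close>-product of the \<phi>-images, evaluated at constant series.\<close>

definition hom_defect ::
  "('a::ab_group_add \<Rightarrow> 'a \<Rightarrow> 'a) \<Rightarrow> (nat \<Rightarrow> 'a \<Rightarrow> 'a \<Rightarrow> 'a) \<Rightarrow> (nat \<Rightarrow> 'a \<Rightarrow> 'a) \<Rightarrow> nat \<Rightarrow> 'a \<Rightarrow> 'a \<Rightarrow> 'a"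
  where "hom_defect p P \<phi> n x y =
    (\<Sum>i\<le>n. \<phi> i (P (n - i) x y)) - (\<Sum>i\<le>n. p (\<phi> i x) (\<phi> (n - i) y))"

text \<open>Group both sides by the total degree m of the coefficient maps involved. For fixed
  coefficients of \<open>X\<close> and \<open>Y\<close>, the difference in degree m is then exactly
  \<open>hom_defect p P \<phi> m\<close>.\<close>

lemma series_map_series_product:
  assumes "\<And>i. additive (\<phi> i)" "biadditive p"
  shows "series_map \<phi> (series_product P X Y)
    = extend_product p (series_map \<phi> X) (series_map \<phi> Y) + series_product (hom_defect p P \<phi>) X Y"
proof (rule fps_ext)
  fix n
  have "fps_nth (series_map \<phi> (series_product P X Y)) n
    = (\<Sum>i\<le>n. \<Sum>m\<le>n - i. \<Sum>j\<le>n - i - m. \<phi> i (P m (fps_nth X j) (fps_nth Y (n - i - m - j))))"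
    by (simp add: series_map_def series_product_def additive.sum[OF assms(1)] add.assoc)
  also have "\<dots> = (\<Sum>m\<le>n. \<Sum>i\<le>m. \<Sum>j\<le>n - m. \<phi> i (P (m - i) (fps_nth X j) (fps_nth Y (n - m - j))))"
    by (rule sum_triangle_assoc[symmetric])
  also have "\<dots> = (\<Sum>m\<le>n. \<Sum>j\<le>n - m. \<Sum>i\<le>m. \<phi> i (P (m - i) (fps_nth X j) (fps_nth Y (n - m - j))))"
    by (intro sum.cong sum.swap refl)
  finally have 1: "fps_nth (series_map \<phi> (series_product P X Y)) n = \<dots>" .
  have "fps_nth (extend_product p (series_map \<phi> X) (series_map \<phi> Y)) n
    = (\<Sum>j\<le>n. \<Sum>i\<le>j. \<Sum>k\<le>n - j. p (\<phi> i (fps_nth X (j - i))) (\<phi> k (fps_nth Y (n - j - k))))"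
    by (auto simp: extend_product_def series_map_def biadditive_simps[OF assms(2)]
        intro!: sum.cong sum.swap)
  also have "\<dots> = (\<Sum>m\<le>n. \<Sum>j\<le>n - m. \<Sum>i\<le>m.
      p (\<phi> i (fps_nth X j)) (\<phi> (m - i) (fps_nth Y (n - m - j))))"
    by (rule sum_quadruple_swap)
  finally have 2: "fps_nth (extend_product p (series_map \<phi> X) (series_map \<phi> Y)) n = \<dots>" .
  show "fps_nth (series_map \<phi> (series_product P X Y)) n
    = fps_nth (extend_product p (series_map \<phi> X) (series_map \<phi> Y)
        + series_product (hom_defect p P \<phi>) X Y) n"
    unfolding fps_add_nth 1 2
    by (simp add: series_product_def hom_defect_def sum_subtractf)
qed

text \<open>Indices with i + j + k = n and i at least n force i = n and j = k = 0.\<close>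

lemma series_product_nth_leading:
  assumes "\<And>m x y. m < n \<Longrightarrow> e m x y = 0"
  shows "fps_nth (series_product e X Y) n = e n (fps_nth X 0) (fps_nth Y 0)"
proof -
  have "fps_nth (series_product e X Y) n =
    (\<Sum>i\<le>n. if i = n then e n (fps_nth X 0) (fps_nth Y 0) else 0)"
    unfolding series_product_def fps_nth_Abs_fps
    by (intro sum.cong refl) (auto simp: assms)
  then show ?thesis by simp
qed

lemma extend_product_nth_leading:
  assumes p: "biadditive p"
  shows "(\<And>m. m < n \<Longrightarrow> fps_nth X m = 0) \<Longrightarrow> fps_nth (extend_product p X Y) n = p (fps_nth X n) (fps_nth Y 0)"
    "(\<And>m. m < n \<Longrightarrow> fps_nth X m = 0) \<Longrightarrow> fps_nth (extend_product p Y X) n = p (fps_nth Y 0) (fps_nth X n)"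
proof -
  assume X: "\<And>m. m < n \<Longrightarrow> fps_nth X m = 0"
  have "fps_nth (extend_product p X Y) n = (\<Sum>j\<le>n. if j = n then p (fps_nth X n) (fps_nth Y 0) else 0)"
    unfolding extend_product_def fps_nth_Abs_fps
    by (intro sum.cong refl) (auto simp: X biadditive_simps[OF p])
  then show "fps_nth (extend_product p X Y) n = p (fps_nth X n) (fps_nth Y 0)" by simp
  have "fps_nth (extend_product p Y X) n = (\<Sum>j\<le>n. if j = 0 then p (fps_nth Y 0) (fps_nth X n) else 0)"
    unfolding extend_product_def fps_nth_Abs_fps
    by (intro sum.cong refl) (auto simp: X biadditive_simps[OF p])
  then show "fps_nth (extend_product p Y X) n = p (fps_nth Y 0) (fps_nth X n)" by simp
qed

text \<open>Moving \<phi> past the outer and then the inner product adds a defect series each time.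
  Both series start in degree n, so at t^n everything else enters through its constant term, where
  \<phi> is the identity and \<open>Q\<close> is \<open>q\<close>.\<close>

lemma left_sym_leading_defect:
  assumes p: "biadditive p" and q: "biadditive q" and \<phi>: "\<And>i. additive (\<phi> i)"
    and id: "\<phi> 0 = id" and Q0: "Q 0 = q"
    and Ep: "\<And>m x y. m < n \<Longrightarrow> hom_defect p P \<phi> m x y = 0"
    and Eq: "\<And>m x y. m < n \<Longrightarrow> hom_defect q Q \<phi> m x y = 0"
  shows "fps_nth (series_map \<phi> (left_sym (series_product P) (series_product Q)
             (fps_const x) (fps_const y) (fps_const z))) n
    = fps_nth (left_sym (extend_product p) (extend_product q) (series_map \<phi> (fps_const x))
        (series_map \<phi> (fps_const y)) (series_map \<phi> (fps_const z))) n
      + left_sym (hom_defect p P \<phi> n) q x y z + left_sym p (hom_defect q Q \<phi> n) x y z"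
proof -
  let ?F = "series_map \<phi>" and ?p = "extend_product p" and ?q = "extend_product q"
    and ?P = "series_product P" and ?Q = "series_product Q"
    and ?d = "hom_defect p P \<phi>" and ?e = "hom_defect q Q \<phi>"
  note ext = biadditive_simps[OF biadditive_extend_product[OF p]]
  note F = additive_series_map[OF \<phi>]
  have F0: "fps_nth (?F X) 0 = fps_nth X 0" for X by (simp add: series_map_def id)
  have Q0': "fps_nth (?Q X Y) 0 = q (fps_nth X 0) (fps_nth Y 0)" for X Y
    by (simp add: series_product_def Q0)
  have e0: "fps_nth (series_product ?e X Y) m = 0" if "m < n" for m X Y
    using series_product_nth_leading[of m ?e X Y] Eq that by simp
  have en: "fps_nth (series_product ?e X Y) n = ?e n (fps_nth X 0) (fps_nth Y 0)" for X Y
    by (rule series_product_nth_leading) (rule Eq)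
  have dn: "fps_nth (series_product ?d X Y) n = ?d n (fps_nth X 0) (fps_nth Y 0)" for X Y
    by (rule series_product_nth_leading) (rule Ep)
  have L: "fps_nth (?F (?P (?Q X Y) Z)) n = fps_nth (?p (?q (?F X) (?F Y)) (?F Z)) n
      + ?d n (q (fps_nth X 0) (fps_nth Y 0)) (fps_nth Z 0)
      + p (?e n (fps_nth X 0) (fps_nth Y 0)) (fps_nth Z 0)" for X Y Z
    by (simp add: series_map_series_product[OF \<phi> p, where P = P]
        series_map_series_product[OF \<phi> q, where P = Q] ext
        dn Q0' extend_product_nth_leading[OF p e0] en F0)
  have R: "fps_nth (?F (?P X (?Q Y Z))) n = fps_nth (?p (?F X) (?q (?F Y) (?F Z))) n
      + ?d n (fps_nth X 0) (q (fps_nth Y 0) (fps_nth Z 0))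
      + p (fps_nth X 0) (?e n (fps_nth Y 0) (fps_nth Z 0))" for X Y Z
    by (simp add: series_map_series_product[OF \<phi> p, where P = P]
        series_map_series_product[OF \<phi> q, where P = Q] ext
        dn Q0' extend_product_nth_leading[OF p e0] en F0)
  show ?thesis
    by (simp add: left_sym_def additive.add[OF F] additive.diff[OF F] L R)
qed

text \<open>Only the indices 0 and n, distinct as \<open>n > 0\<close>, involve the new coefficient.
  There the other factor is \<open>p\<close> or \<open>id\<close>, so the contribution is
  \<open>g (p x y) - p x (g y) - p (g x) y\<close>.\<close>

lemma hom_defect_upd:
  assumes "n > 0" "\<phi> 0 = id" "P 0 = p" "biadditive p"
  shows "hom_defect p P (\<phi>(n := g)) n = hom_defect p P (\<phi>(n := 0)) n - delta1 p g"
proof (intro ext)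
  fix x y
  obtain k where n: "n = Suc k" using assms(1) by (cases n) auto
  have 1: "(\<Sum>i\<le>n. (\<phi>(n := h)) i (P (n - i) x y)) = (\<Sum>i\<le>k. \<phi> i (P (n - i) x y)) + h (p x y)" for h
    using assms(3) by (simp add: n)
  have 2: "(\<Sum>i\<le>n. p ((\<phi>(n := h)) i x) ((\<phi>(n := h)) (n - i) y))
     = p x (h y) + (\<Sum>i=1..k. p (\<phi> i x) (\<phi> (n - i) y)) + p (h x) y" for h
  proof -
    have "{..n} = insert 0 (insert n {1..k})" by (auto simp: n)
    moreover have "(\<Sum>i=1..k. p ((\<phi>(n := h)) i x) ((\<phi>(n := h)) (n - i) y))
        = (\<Sum>i=1..k. p (\<phi> i x) (\<phi> (n - i) y))"
      by (rule sum.cong) (auto simp: n)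
    ultimately show ?thesis using assms(2) by (simp add: n add_ac)
  qed
  show "hom_defect p P (\<phi>(n := g)) n x y = (hom_defect p P (\<phi>(n := 0)) n - delta1 p g) x y"
    unfolding hom_defect_def 1 2 fun_diff_def delta1_def
    by (simp add: biadditive_simps[OF assms(4)])
qed

lemma hom_defect_cong:
  assumes "\<And>i. i \<le> n \<Longrightarrow> \<phi> i = \<psi> i"
  shows "hom_defect p P \<phi> n = hom_defect p P \<psi> n"
  by (simp add: hom_defect_def fun_eq_iff assms)

lemma bilinear_map_hom_defect:
  assumes "module scale" "bilinear_map scale p" "\<And>i. bilinear_map scale (P i)"
    "\<And>i. module_hom scale scale (\<phi> i)"
  shows "bilinear_map scale (hom_defect p P \<phi> n)"
proof -
  interpret module scale by fact
  show ?thesis using assms(2-)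
    unfolding bilinear_map_def hom_defect_def module_hom_iff
    by (simp add: sum.distrib scale_sum_right scale_right_diff_distrib)
qed

section \<open>Exploiting the vanishing of cohomology\<close>

text \<open>The zero map makes the relation reflexive on cocycles, so a cocycle lies in its own
  class. With a single class, this is the class of 0.\<close>

lemma cocycle_imp_coboundary:
  assumes "vector_space scale" "bilinear_map scale p1" "bilinear_map scale p2"
    and H: "cohomology2 scale p1 p2 = {cohomology2_zero scale p1 p2}"
    and c: "(w1, w2) \<in> cocycles2 scale p1 p2"
  obtains f where "module_hom scale scale f" "w1 = delta1 p1 f" "w2 = delta1 p2 f"
proof -
  interpret vector_space scale by fact
  let ?c = "(w1, w2)" and ?R = "cohomologous2 scale p1 p2"
  note p = biadditive_simps[OF bilinear_map_imp_biadditive[OF assms(2)]]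
    biadditive_simps[OF bilinear_map_imp_biadditive[OF assms(3)]]
  have "module_hom scale scale (\<lambda>_. 0)" by (simp add: module_hom_iff module_axioms)
  moreover have "delta1 p1 (\<lambda>_. 0) = 0" "delta1 p2 (\<lambda>_. 0) = 0"
    by (simp_all add: delta1_def fun_eq_iff p)
  ultimately have "0 \<in> coboundaries2 scale p1 p2"
    unfolding coboundaries2_def zero_prod_def by force
  then have "(?c, ?c) \<in> ?R" using c by (simp add: cohomologous2_def)
  moreover have "?R `` {?c} = ?R `` {0}"
    using quotientI[OF c, of ?R] H by (simp add: cohomology2_def cohomology2_zero_def)
  ultimately have "(0, ?c) \<in> ?R" by blast
  \<comment> \<open>Membership in the class of 0 concerns the difference 0 - c, which is why the
    final witness is the negative of \<open>f\<close>.\<close>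
  then have "- ?c \<in> coboundaries2 scale p1 p2" by (simp add: cohomologous2_def)
  then obtain f where f: "module_hom scale scale f" "- w1 = delta1 p1 f" "- w2 = delta1 p2 f"
    unfolding coboundaries2_def by auto
  have "module_hom scale scale (\<lambda>x. - f x)"
    using f(1) by (simp add: module_hom_iff)
  moreover have "w1 = delta1 p1 (\<lambda>x. - f x)" "w2 = delta1 p2 (\<lambda>x. - f x)"
    using f(2,3)
    by (simp_all add: delta1_def fun_eq_iff p algebra_simps)
  ultimately show ?thesis by (rule that)
qed

section \<open>Trivialising a fixed deformation degree by degree\<close>

context
  fixes scale :: "'k::field \<Rightarrow> 'a::ab_group_add \<Rightarrow> 'a" and p1 p2 P1 P2
  assumes vs: "vector_space scale"
    and base: "compatible_pre_lie_algebra scale p1 p2"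
    and deform: "formal_deformation scale p1 p2 P1 P2"
begin

lemma base_bilinear: "bilinear_map scale p1" "bilinear_map scale p2"
  using base unfolding compatible_pre_lie_algebra_def
  by (simp_all add: pre_lie_algebra.bilinear)

lemma deform_bilinear: "bilinear_map scale (P1 i)" "bilinear_map scale (P2 i)"
  and deform_0: "P1 0 = p1" "P2 0 = p2"
  and deform_compatible:
    "compatible_pre_lie_algebra (fps_scale scale) (series_product P1) (series_product P2)"
  using deform by (auto simp: formal_deformation_def)

text \<open>The three cocycle equations come from the left-symmetry of each product and from
  compatibility, each read off at t^n on constant series.\<close>

lemma hom_defect_cocycle:
  assumes \<phi>: "\<And>i. module_hom scale scale (\<phi> i)" and id: "\<phi> 0 = id"
    and d1: "\<And>m. m < n \<Longrightarrow> hom_defect p1 P1 \<phi> m = 0"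
    and d2: "\<And>m. m < n \<Longrightarrow> hom_defect p2 P2 \<phi> m = 0"
  shows "(hom_defect p1 P1 \<phi> n, hom_defect p2 P2 \<phi> n) \<in> cocycles2 scale p1 p2"
proof -
  interpret vector_space scale by (rule vs)
  let ?w1 = "hom_defect p1 P1 \<phi> n" and ?w2 = "hom_defect p2 P2 \<phi> n"
  have bl: "bilinear_map scale ?w1" "bilinear_map scale ?w2"
    by (intro bilinear_map_hom_defect module_axioms base_bilinear deform_bilinear \<phi>)+
  note add = base_bilinear[THEN bilinear_map_imp_biadditive]
  note leading = left_sym_leading_defect[where \<phi> = \<phi> and n = n, OF _ _ module_hom_imp_additive[OF \<phi>] id]
  note F = additive_series_map[of \<phi>, OF module_hom_imp_additive[OF \<phi>]]
  note B = compatible_pre_lie_algebra_left_sym[OF base]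
  note D = compatible_pre_lie_algebra_left_sym[OF deform_compatible]
  \<comment> \<open>The base identities are needed for arbitrary series, since \<phi> maps a
    constant series to one that is in general not constant.\<close>
  have B': "left_sym (extend_product p1) (extend_product p1) X Y Z = 0"
    "left_sym (extend_product p2) (extend_product p2) X Y Z = 0"
    "left_sym (extend_product p1) (extend_product p2) X Y Z
      + left_sym (extend_product p2) (extend_product p1) X Y Z = 0" for X Y Z
    by (simp_all add: fps_eq_iff left_sym_extend_product add B flip: sum.distrib)
  have 1: "left_sym ?w1 p1 x y z + left_sym p1 ?w1 x y z = 0" for x y z
    using leading[of p1 p1 P1 P1 x y z] additive.zero[OF F] by (simp add: add deform_0 d1 D B')
  have 2: "left_sym ?w2 p2 x y z + left_sym p2 ?w2 x y z = 0" for x y z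
    using leading[of p2 p2 P2 P2 x y z] additive.zero[OF F] by (simp add: add deform_0 d2 D B')
  \<comment> \<open>Neither mixed \<open>left_sym\<close> has to vanish alone, so the leading-term
    formula is used for both orders of the products and the results are added.\<close>
  have 3: "left_sym ?w1 p2 x y z + left_sym p1 ?w2 x y z
      + left_sym ?w2 p1 x y z + left_sym p2 ?w1 x y z = 0" for x y z
  proof -
    let ?F = "series_map \<phi>" and ?c = fps_const
    let ?l = "\<lambda>P Q. left_sym (series_product P) (series_product Q) (?c x) (?c y) (?c z)"
    let ?r = "\<lambda>p q. left_sym (extend_product p) (extend_product q) (?F (?c x)) (?F (?c y)) (?F (?c z))"
    have "fps_nth (?F (?l P1 P2)) n + fps_nth (?F (?l P2 P1)) n = 0"
      using D(3)[of "?c x" "?c y" "?c z"] additive.zero[OF F]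
      by (metis additive.add[OF F] fps_add_nth fps_zero_nth)
    moreover have "fps_nth (?r p1 p2) n + fps_nth (?r p2 p1) n = 0"
      by (metis B'(3) fps_add_nth fps_zero_nth)
    moreover have "fps_nth (?F (?l P1 P2)) n
        = fps_nth (?r p1 p2) n + left_sym ?w1 p2 x y z + left_sym p1 ?w2 x y z"
      by (rule leading) (simp_all add: add deform_0 d1 d2)
    moreover have "fps_nth (?F (?l P2 P1)) n
        = fps_nth (?r p2 p1) n + left_sym ?w2 p1 x y z + left_sym p2 ?w1 x y z"
      by (rule leading) (simp_all add: add deform_0 d1 d2)
    ultimately show ?thesis by (smt (verit) add.assoc add.commute add.left_neutral)
  qed
  note delta = delta2_eq_left_sym[OF bilinear_map_imp_biadditive[OF bl(1)]]
    delta2_eq_left_sym[OF bilinear_map_imp_biadditive[OF bl(2)]]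
  have "delta2 p1 ?w1 = 0" "delta2 p2 ?w2 = 0"
    by (simp_all add: fun_eq_iff delta 1 2 add.commute[of "left_sym p1 _ _ _ _"] add.commute[of "left_sym p2 _ _ _ _"])
  moreover have "delta2 p2 ?w1 + delta2 p1 ?w2 = 0"
  proof (intro ext)
    fix x y z
    have "(delta2 p2 ?w1 + delta2 p1 ?w2) x y z = - (left_sym ?w1 p2 x y z + left_sym p1 ?w2 x y z
      + left_sym ?w2 p1 x y z + left_sym p2 ?w1 x y z)"
      by (simp add: delta)
    then show "(delta2 p2 ?w1 + delta2 p1 ?w2) x y z = 0 x y z" by (simp add: 3)
  qed
  ultimately show ?thesis using bl by (simp add: cocycles2_def)
qed

lemma trivialising_step:
  assumes H: "cohomology2 scale p1 p2 = {cohomology2_zero scale p1 p2}"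
    and n: "n > 0" and \<phi>: "\<And>i. i < n \<Longrightarrow> module_hom scale scale (\<phi> i)" and id: "\<phi> 0 = id"
    and d: "\<And>m. m < n \<Longrightarrow> hom_defect p1 P1 \<phi> m = 0" "\<And>m. m < n \<Longrightarrow> hom_defect p2 P2 \<phi> m = 0"
  obtains f where "module_hom scale scale f"
    "hom_defect p1 P1 (\<phi>(n := f)) n = 0" "hom_defect p2 P2 (\<phi>(n := f)) n = 0"
proof -
  interpret vector_space scale by (rule vs)
  \<comment> \<open>Linearity is known only below n. Truncation makes all coefficients linear
    without affecting lower defects, and sets the coefficient at n to zero, so that the resulting
    defect \<open>delta1 p f\<close> is cancelled by inserting \<open>f\<close>.\<close>
  define \<psi> where "\<psi> i = (if i < n then \<phi> i else 0)" for i
  have eq: "hom_defect p P \<psi> m = hom_defect p P \<phi> m" if "m < n" for p P m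
    by (rule hom_defect_cong) (use that in \<open>simp add: \<psi>_def\<close>)
  have eqn: "hom_defect p P \<psi> n = hom_defect p P (\<phi>(n := 0)) n" for p P
    by (rule hom_defect_cong) (simp add: \<psi>_def)
  have zero: "module_hom scale scale 0" by (simp add: module_hom_iff module_axioms)
  have "(hom_defect p1 P1 \<psi> n, hom_defect p2 P2 \<psi> n) \<in> cocycles2 scale p1 p2"
    by (rule hom_defect_cocycle) (use n in \<open>simp_all add: eq d, simp_all add: \<psi>_def \<phi> id zero\<close>)
  from cocycle_imp_coboundary[OF vs base_bilinear H this]
  obtain f where "module_hom scale scale f"
    "hom_defect p1 P1 (\<phi>(n := 0)) n = delta1 p1 f" "hom_defect p2 P2 (\<phi>(n := 0)) n = delta1 p2 f"
    unfolding eqn by blast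
  then show ?thesis
    using that[of f] hom_defect_upd[of n \<phi> _ _ f] n id deform_0
      base_bilinear[THEN bilinear_map_imp_biadditive] by simp
qed

lemma trivialising_series:
  assumes H: "cohomology2 scale p1 p2 = {cohomology2_zero scale p1 p2}"
  obtains \<phi> where "\<And>i. module_hom scale scale (\<phi> i)" "\<phi> 0 = id"
    "\<And>n. hom_defect p1 P1 \<phi> n = 0" "\<And>n. hom_defect p2 P2 \<phi> n = 0"
proof -
  interpret vector_space scale by (rule vs)
  \<comment> \<open>The update at n lets the condition on \<open>f\<close> depend on \<phi> only
    below n, as well-founded choice requires. For the chosen series,
    \<open>\<phi>(n := \<phi> n)\<close> is \<phi> again.\<close>
  let ?G = "\<lambda>\<phi> n f. module_hom scale scale f \<and> (n = 0 \<longrightarrow> f = id) \<and>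
    hom_defect p1 P1 (\<phi>(n := f)) n = 0 \<and> hom_defect p2 P2 (\<phi>(n := f)) n = 0"
  have "\<exists>\<phi>. \<forall>n. ?G \<phi> n (\<phi> n)"
  proof (rule dependent_wf_choice[OF wf_less])
    fix \<phi> \<psi> :: "nat \<Rightarrow> 'a \<Rightarrow> 'a" and n f
    assume "\<And>m. (m, n) \<in> {(x, y). x < y} \<Longrightarrow> \<phi> m = \<psi> m"
    then have "hom_defect p P (\<phi>(n := f)) n = hom_defect p P (\<psi>(n := f)) n" for p P
      by (intro hom_defect_cong) simp
    then show "?G \<phi> n f = ?G \<psi> n f" by simp
  next
    fix n \<phi>
    assume "\<And>m. (m, n) \<in> {(x, y). x < y} \<Longrightarrow> ?G \<phi> m (\<phi> m)"
    then have IH: "?G \<phi> m (\<phi> m)" if "m < n" for m using that by simp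
    show "\<exists>f. ?G \<phi> n f"
    proof (cases "n = 0")
      case True
      then show ?thesis
        \<comment> \<open>In degree 0 the defect of \<open>id\<close> is \<open>P 0 - p\<close>,
          which is zero.\<close>
        by (intro exI[of _ id])
          (simp add: module_hom_iff module_axioms hom_defect_def fun_eq_iff deform_0)
    next
      case False
      have "\<exists>f. module_hom scale scale f \<and> hom_defect p1 P1 (\<phi>(n := f)) n = 0
          \<and> hom_defect p2 P2 (\<phi>(n := f)) n = 0"
        by (rule trivialising_step[OF H, of n \<phi>]) (use IH False in auto)
      then show ?thesis using False by blast
    qed
  qed
  then show ?thesis using that by auto
qed

end

section \<open>From vanishing defects to rigidity\<close>

theorem theorem3p18:
  fixes scale :: "'k::field \<Rightarrow> 'a::ab_group_add \<Rightarrow> 'a"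
    and p1 p2 :: "'a \<Rightarrow> 'a \<Rightarrow> 'a"
  assumes "vector_space scale"
    and "compatible_pre_lie_algebra scale p1 p2"
    and "cohomology2 scale p1 p2 = {cohomology2_zero scale p1 p2}"
  shows "rigid scale p1 p2"
  unfolding rigid_def
proof (intro allI impI)
  fix P1 P2
  assume deform: "formal_deformation scale p1 p2 P1 P2"
  from trivialising_series[OF assms(1,2) this assms(3)]
  obtain \<phi> where \<phi>: "\<And>i. module_hom scale scale (\<phi> i)" "\<phi> 0 = id"
    and d: "\<And>n. hom_defect p1 P1 \<phi> n = 0" "\<And>n. hom_defect p2 P2 \<phi> n = 0"
    by blast
  \<comment> \<open>The error term is the series product of the defects, so it vanishes; keeping
    \<open>p\<close> and \<open>P\<close> general covers both products.\<close>
  have "series_map \<phi> (series_product P X Y) = extend_product p (series_map \<phi> X) (series_map \<phi> Y)"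
    if "bilinear_map scale p" "\<And>n. hom_defect p P \<phi> n = 0" for p P X Y
  proof -
    have "series_product (hom_defect p P \<phi>) X Y = 0"
      by (simp add: series_product_def fps_eq_iff that(2))
    then show ?thesis
      using series_map_series_product[of \<phi> p P X Y] module_hom_imp_additive[OF \<phi>(1)]
        bilinear_map_imp_biadditive[OF that(1)] by simp
  qed
  then show "trivial_deformation scale p1 p2 P1 P2"
    unfolding trivial_deformation_def
    using \<phi> d base_bilinear[OF assms(1,2) deform] by blast
qed

end
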